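(* Let $\mu\in\mathbb{R}^{n}$ and let $\Sigma_{0},\Sigma_{1}\in\mathbb{R}^{n\times n}$ be two symmetric positive definite matrices. Suppose that $$(1-n^{-1})\Sigma_{0}\preceq\Sigma_{1}\preceq(1+n^{-1})\Sigma_{0}.$$ Then $$D_{\mathbf{KL}}\left(\mathcal{N}(\mu,\Sigma_{0}),\mathcal{N}(\mu,\Sigma_{1})\right)\leq 1+O(n^{-1}).$$
   Context: For Hermitian matrices $A,B$ of the same size, $A\preceq B$ means that $B-A$ is positive semidefinite. $\mathcal{N}(\mu,\Sigma)$ is the multivariate normal distribution on $\mathbb{R}^n$ with mean $\mu$ and covariance $\Sigma$. $D_{\mathbf{KL}}(\mathcal{P},\mathcal{Q})$ is the Kullback--Leibler divergence; for normal distributions with $\mathcal{N}_1=\mathcal{N}(\mu_0,\Sigma_0)$, $\mathcal{N}_2=\mathcal{N}(\mu_1,\Sigma_1)$ on $\mathbb{R}^n$ it equals $$D_{\mathbf{KL}}(\mathcal{N}_1,\mathcal{N}_2)=\tfrac12\mathrm{Tr}(\Sigma_1^{-1}\Sigma_0)+\tfrac12(\mu_1-\mu_0)^{T}\Sigma_1^{-1}(\mu_1-\mu_0)+\tfrac12(\log\det\Sigma_1-\log\det\Sigma_0)-\tfrac n2 .$$ The $O(n^{-1})$ is as $n\to\infty$, with an absolute implied constant (not depending on $\mu,\Sigma_0,\Sigma_1$). *)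

theory Defs
  imports
    "HOL-Probability.Information"
    "HOL-Library.Landau_Symbols"
    "Jordan_Normal_Form.Determinant"
    "Jordan_Normal_Form.Gauss_Jordan_Elimination"
begin

text \<open>
  The dimension has to be quantified inside a formula, so matrices and vectors are those of
  \<^theory>\<open>Jordan_Normal_Form.Matrix\<close>. Its constants \<open>det\<close> and \<open>vec\<close> share their base names with
  constants of the analysis library and are therefore written with qualified names.
\<close>

definition pos_semidef :: "real mat \<Rightarrow> bool" where
  "pos_semidef A \<longleftrightarrow> square_mat A \<and> transpose_mat A = A \<and>
     (\<forall>v \<in> carrier_vec (dim_row A). 0 \<le> scalar_prod v (A *\<^sub>v v))"

definition pos_def :: "real mat \<Rightarrow> bool" where
  "pos_def A \<longleftrightarrow> square_mat A \<and> transpose_mat A = A \<and>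
     (\<forall>v \<in> carrier_vec (dim_row A). v \<noteq> 0\<^sub>v (dim_row A) \<longrightarrow> 0 < scalar_prod v (A *\<^sub>v v))"

text \<open>The Loewner order; only meaningful for symmetric matrices of the same size.\<close>

definition loewner_le :: "real mat \<Rightarrow> real mat \<Rightarrow> bool" (infix \<open>\<preceq>\<^sub>L\<close> 50) where
  "A \<preceq>\<^sub>L B \<longleftrightarrow> pos_semidef (B - A)"

text \<open>
  A point of $n$-dimensional space is represented in the product measure by an (extensional)
  function on \<open>{..<n}\<close>, so \<open>Matrix.vec n x\<close> is the corresponding vector. The inverse below is
  the genuine one whenever \<open>S\<close> is invertible, in particular for positive definite \<open>S\<close>.
\<close>

definition mvn_density :: "nat \<Rightarrow> real vec \<Rightarrow> real mat \<Rightarrow> (nat \<Rightarrow> real) \<Rightarrow> real" where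
  "mvn_density n \<mu> S x =
     exp (- (1/2) * scalar_prod (Matrix.vec n x - \<mu>) (the (mat_inverse S) *\<^sub>v (Matrix.vec n x - \<mu>)))
       / sqrt ((2 * pi) ^ n * Determinant.det S)"

definition mvn :: "nat \<Rightarrow> real vec \<Rightarrow> real mat \<Rightarrow> (nat \<Rightarrow> real) measure" where
  "mvn n \<mu> S = density (\<Pi>\<^sub>M i\<in>{..<n}. lborel) (\<lambda>x. ennreal (mvn_density n \<mu> S x))"

text \<open>
  \<^const>\<open>KL_divergence\<close> integrates the log-density of its last argument with respect to the
  last argument, hence the swap; the logarithm is the natural one. The real-valued integral is the
  usual divergence when \<open>P\<close> is absolutely continuous with respect to \<open>Q\<close> and the log-density is
  \<open>P\<close>-integrable, as is the case for nondegenerate normal distributions on the same space, where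
  the log-density is a quadratic polynomial.
\<close>

definition D_KL :: "'a measure \<Rightarrow> 'a measure \<Rightarrow> real" where
  "D_KL P Q = KL_divergence (exp 1) Q P"

end

theory Submission
  imports Defs "HOL-Real_Asymp.Real_Asymp"
    "HOL-Probability.Distributions"
begin

text \<open>
  With \<open>Q\<^sub>i\<close> the quadratic form of \<open>\<Sigma>\<^sub>i\<^sup>-\<^sup>1\<close> centred at \<open>\<mu>\<close>, the log-density is
  \<open>(Q\<^sub>1 - Q\<^sub>0) / 2 + ln (det \<Sigma>\<^sub>1 / det \<Sigma>\<^sub>0) / 2\<close>. Inversion is antitone, so the lower Loewner bound gives
  \<open>Q\<^sub>1 - Q\<^sub>0 \<le> Q\<^sub>0 / (n - 1)\<close>; the determinant is monotone, so the upper one gives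
  \<open>det \<Sigma>\<^sub>1 / det \<Sigma>\<^sub>0 \<le> (1 + 1/n)^n \<le> exp 1\<close>. The expectation of \<open>Q\<^sub>0\<close> is controlled without computing
  second moments: \<open>s Q\<^sub>0 / 2 \<le> exp (s Q\<^sub>0 / 2) - 1\<close>, and the expectation of \<open>exp (s Q\<^sub>0 / 2)\<close> is
  \<open>(1 - s) powr (- n / 2)\<close> by the normalisation of the Gaussian with precision matrix
  \<open>(1 - s) \<Sigma>\<^sub>0\<^sup>-\<^sup>1\<close>. The choice \<open>s = 1 / n\<^sup>2\<close> costs only an error of order \<open>1 / n\<close>.

  The Gaussian integral itself is evaluated by induction on the dimension, integrating out the last
  coordinate, which replaces the precision matrix by its Schur complement.
\<close>

section \<open>Quadratic forms and positive definite matrices\<close>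

definition qform :: "real mat \<Rightarrow> real vec \<Rightarrow> real" where
  "qform A v = scalar_prod v (A *\<^sub>v v)"

lemma qform_sum:
  assumes "A \<in> carrier_mat n n" "v \<in> carrier_vec n"
  shows "qform A v = (\<Sum>i<n. \<Sum>j<n. A $$ (i,j) * v $ i * v $ j)"
proof -
  have "qform A v = (\<Sum>i\<in>{0..<n}. v $ i * (\<Sum>j\<in>{0..<n}. A $$ (i,j) * v $ j))"
    using assms by (auto simp: qform_def scalar_prod_def intro!: sum.cong)
  then show ?thesis
    by (simp add: sum_distrib_left mult_ac lessThan_atLeast0)
qed

lemma qform_smult:
  assumes "A \<in> carrier_mat n n" "v \<in> carrier_vec n"
  shows "qform (c \<cdot>\<^sub>m A) v = c * qform A v"
proof -
  have "qform (c \<cdot>\<^sub>m A) v = (\<Sum>i<n. \<Sum>j<n. (c \<cdot>\<^sub>m A) $$ (i,j) * v $ i * v $ j)"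
    using assms by (intro qform_sum) auto
  also have "\<dots> = (\<Sum>i<n. \<Sum>j<n. c * (A $$ (i,j) * v $ i * v $ j))"
    using assms by (intro sum.cong) auto
  finally show ?thesis
    using assms by (simp add: qform_sum sum_distrib_left)
qed

lemma pos_def_iff:
  assumes "A \<in> carrier_mat n n"
  shows "pos_def A \<longleftrightarrow> transpose_mat A = A \<and>
    (\<forall>v\<in>carrier_vec n. v \<noteq> 0\<^sub>v n \<longrightarrow> 0 < qform A v)"
  using assms by (auto simp: pos_def_def qform_def)

lemma loewner_le_qform:
  assumes "A \<in> carrier_mat n n" "B \<in> carrier_mat n n" "v \<in> carrier_vec n" "A \<preceq>\<^sub>L B"
  shows "qform A v \<le> qform B v"
proof -
  have "0 \<le> qform (B - A) v"
    using assms by (auto simp: loewner_le_def pos_semidef_def qform_def)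
  also have "qform (B - A) v = (\<Sum>i<n. \<Sum>j<n. (B - A) $$ (i,j) * v $ i * v $ j)"
    using assms by (intro qform_sum) auto
  also have "\<dots> = (\<Sum>i<n. \<Sum>j<n. B $$ (i,j) * v $ i * v $ j - A $$ (i,j) * v $ i * v $ j)"
    using assms by (intro sum.cong) (auto simp: algebra_simps)
  also have "\<dots> = qform B v - qform A v"
    using assms by (simp add: qform_sum sum_subtractf)
  finally show ?thesis by simp
qed

lemma pos_def_smult:
  assumes "A \<in> carrier_mat n n" "pos_def A" "0 < c"
  shows "pos_def (c \<cdot>\<^sub>m A)"
proof -
  have "transpose_mat (c \<cdot>\<^sub>m A) = c \<cdot>\<^sub>m transpose_mat A"
    by (intro eq_matI) auto
  then show ?thesis
    using assms by (subst pos_def_iff[of _ n]) (auto simp: qform_smult pos_def_iff[of A n])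
qed

lemma pos_def_diag_pos:
  assumes A: "A \<in> carrier_mat n n" "pos_def A" and k: "k < n"
  shows "0 < A $$ (k,k)"
proof -
  have "qform A (unit_vec n k) =
      (\<Sum>i<n. \<Sum>j<n. A $$ (i,j) * unit_vec n k $ i * unit_vec n k $ j)"
    using A by (intro qform_sum) auto
  also have "\<dots> = (\<Sum>i<n. \<Sum>j<n. if j = k then if i = k then A $$ (k,k) else 0 else 0)"
    using k by (intro sum.cong refl) auto
  also have "\<dots> = A $$ (k,k)"
    using k by (simp add: sum.delta)
  finally show ?thesis
    using A k pos_def_iff[of A n] by (metis unit_vec_carrier unit_vec_nonzero)
qed

section \<open>Elimination of the last coordinate by Schur complements\<close>

definition schur_complement :: "nat \<Rightarrow> real mat \<Rightarrow> real mat" where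
  "schur_complement n A =
     mat n n (\<lambda>(i,j). A $$ (i,j) - A $$ (i,n) * A $$ (n,j) / A $$ (n,n))"

lemma schur_complement_carrier [simp]: "schur_complement n A \<in> carrier_mat n n"
  by (simp add: schur_complement_def)

text \<open>Completing the square in the last coordinate: by symmetry both families of cross terms
  equal \<open>b * u $ n\<close>. Afterwards \<open>u $ n\<close> occurs only inside the square, so
  this coordinate can be integrated out, or chosen so that the square vanishes.\<close>

lemma qform_schur_complement:
  assumes A: "A \<in> carrier_mat (Suc n) (Suc n)" and sym: "transpose_mat A = A"
    and c: "A $$ (n,n) \<noteq> 0" and u: "u \<in> carrier_vec (Suc n)"
  shows "qform A u = qform (schur_complement n A) (Matrix.vec n (($) u)) +
    A $$ (n,n) * (u $ n + (\<Sum>i<n. A $$ (n,i) * u $ i) / A $$ (n,n))\<^sup>2"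
proof -
  define b where "b = (\<Sum>i<n. A $$ (n,i) * u $ i)"
  define q where "q = (\<Sum>i<n. \<Sum>j<n. A $$ (i,j) * u $ i * u $ j)"
  have A_sym: "A $$ (i,n) = A $$ (n,i)" if "i < n" for i
    using that A sym by (metis carrier_matD index_transpose_mat(1) less_SucI lessI)
  have "qform A u = q + (\<Sum>i<n. A $$ (i,n) * u $ i * u $ n) +
      ((\<Sum>i<n. A $$ (n,i) * u $ n * u $ i) + A $$ (n,n) * u $ n * u $ n)"
    using A u by (simp add: qform_sum q_def sum.distrib)
  also have "(\<Sum>i<n. A $$ (i,n) * u $ i * u $ n) = b * u $ n"
    using A_sym by (simp add: b_def sum_distrib_right)
  also have "(\<Sum>i<n. A $$ (n,i) * u $ n * u $ i) = b * u $ n"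
    by (simp add: b_def sum_distrib_left mult_ac)
  finally have 1: "qform A u = q + b * u $ n + (b * u $ n + A $$ (n,n) * u $ n * u $ n)" .
  have "qform (schur_complement n A) (Matrix.vec n (($) u)) =
      (\<Sum>i<n. \<Sum>j<n. schur_complement n A $$ (i,j) * u $ i * u $ j)"
    by (subst qform_sum[of _ n]) auto
  also have "\<dots> = (\<Sum>i<n. \<Sum>j<n. A $$ (i,j) * u $ i * u $ j -
      (A $$ (n,i) * u $ i) * (A $$ (n,j) * u $ j) / A $$ (n,n))"
    using A_sym by (intro sum.cong refl) (simp add: schur_complement_def algebra_simps)
  also have "\<dots> = q - b * b / A $$ (n,n)"
    by (simp add: q_def b_def sum_subtractf sum_product sum_divide_distrib)
  finally have 2: "qform (schur_complement n A) (Matrix.vec n (($) u)) = q - b * b / A $$ (n,n)" .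
  show ?thesis
    unfolding 1 2 b_def[symmetric] using c by (simp add: field_simps power2_eq_square)
qed

text \<open>One step of block elimination, written as \<open>A = ?U * ?L\<close>: \<open>?U\<close>
  is unit upper triangular with determinant 1, and \<open>?L\<close> is block lower triangular with
  the Schur complement and the pivot on its diagonal.\<close>

lemma det_schur_complement:
  assumes A: "A \<in> carrier_mat (Suc n) (Suc n)" and c: "A $$ (n,n) \<noteq> 0"
  shows "Determinant.det A = A $$ (n,n) * Determinant.det (schur_complement n A)"
proof -
  let ?c = "mat 1 1 (\<lambda>_. A $$ (n,n))"
  let ?r = "mat 1 n (\<lambda>(_,j). A $$ (n,j))"
  let ?U = "four_block_mat (1\<^sub>m n) (mat n 1 (\<lambda>(i,_). A $$ (i,n) / A $$ (n,n))) (0\<^sub>m 1 n) (1\<^sub>m 1)"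
  let ?L = "four_block_mat (schur_complement n A) (0\<^sub>m n 1) ?r ?c"
  have "A = four_block_mat (mat n n (($$) A)) (mat n 1 (\<lambda>(i,_). A $$ (i,n))) ?r ?c"
    using A by (intro eq_matI) (auto simp: four_block_mat_def less_Suc_eq)
  also have "\<dots> = ?U * ?L"
    using c by (subst mult_four_block_mat[of _ n n _ 1 _ 1 _ _ n _ 1])
      (auto simp: schur_complement_def scalar_prod_def intro!: cong_four_block_mat eq_matI)
  finally have "Determinant.det A = Determinant.det (?U * ?L)"
    by (rule arg_cong)
  also have "\<dots> = Determinant.det ?U * Determinant.det ?L"
    by (rule det_mult[of _ "n + 1"]) (intro four_block_carrier_mat; simp)+
  also have "Determinant.det ?U = 1"
    by (subst det_four_block_mat_lower_left_zero[of _ n _ 1]) auto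
  also have "Determinant.det ?L = Determinant.det (schur_complement n A) * Determinant.det ?c"
    by (rule det_four_block_mat_upper_right_zero) auto
  also have "Determinant.det ?c = A $$ (n,n)"
    by (subst det_single) auto
  finally show ?thesis by simp
qed

text \<open>Extend \<open>v\<close> by the last coordinate that kills the square in
  \<open>qform_schur_complement\<close>; the form of \<open>A\<close> at the extended vector is then
  the form of the Schur complement at \<open>v\<close>.\<close>

lemma pos_def_schur_complement:
  assumes A: "A \<in> carrier_mat (Suc n) (Suc n)" "pos_def A"
  shows "pos_def (schur_complement n A)"
proof -
  have sym: "transpose_mat A = A"
    using A by (simp add: pos_def_iff)
  have A_sym: "A $$ (i,j) = A $$ (j,i)" if "i \<le> n" "j \<le> n" for i j
    using that A sym by (metis carrier_matD index_transpose_mat(1) less_Suc_eq_le)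
  have c: "0 < A $$ (n,n)"
    using A by (auto intro: pos_def_diag_pos)
  have "0 < qform (schur_complement n A) v" if v: "v \<in> carrier_vec n" "v \<noteq> 0\<^sub>v n" for v
  proof -
    define u where "u = Matrix.vec (Suc n)
      (\<lambda>i. if i < n then v $ i else - (\<Sum>i<n. A $$ (n,i) * v $ i) / A $$ (n,n))"
    have u: "u \<in> carrier_vec (Suc n)" "Matrix.vec n (($) u) = v"
      using v by (auto simp: u_def)
    have "u \<noteq> 0\<^sub>v (Suc n)"
    proof
      assume "u = 0\<^sub>v (Suc n)"
      then have "v = 0\<^sub>v n"
        using u(2) by (metis eq_vecI dim_vec index_vec index_zero_vec less_SucI)
      with v show False by simp
    qed
    then have "0 < qform A u"
      using A u by (simp add: pos_def_iff)
    also have "qform A u = qform (schur_complement n A) v"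
      using qform_schur_complement[OF A(1) sym _ u(1)] c u(2)
      by (simp add: u_def)
    finally show ?thesis .
  qed
  moreover have "transpose_mat (schur_complement n A) = schur_complement n A"
    using A_sym by (intro eq_matI) (auto simp: schur_complement_def)
  ultimately show ?thesis
    by (subst pos_def_iff[of _ n]) auto
qed

section \<open>Gaussian integrals in terms of the precision matrix\<close>

lemma nn_integral_gaussian_real:
  assumes "0 < c"
  shows "(\<integral>\<^sup>+y. ennreal (exp (- (1/2) * (c * (y - a)\<^sup>2))) \<partial>lborel) = ennreal (sqrt (2 * pi / c))"
proof -
  have eq: "exp (- (1/2) * (c * (y - a)\<^sup>2)) = sqrt (2 * pi / c) * normal_density a (1 / sqrt c) y" for y
    using assms by (simp add: normal_density_def power_divide)
  have "(\<integral>\<^sup>+y. ennreal (normal_density a (1 / sqrt c) y) \<partial>lborel) = 1"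
    using assms by (subst nn_integral_eq_integral) auto
  then show ?thesis
    using assms unfolding eq by (simp add: ennreal_mult' nn_integral_cmult)
qed

lemma qform_measurable:
  assumes "A \<in> carrier_mat n n" "\<mu> \<in> carrier_vec n"
  shows "(\<lambda>x. qform A (Matrix.vec n x - \<mu>)) \<in> borel_measurable (\<Pi>\<^sub>M i\<in>{..<n}. lborel)"
proof -
  have "qform A (Matrix.vec n x - \<mu>) =
      (\<Sum>i<n. \<Sum>j<n. A $$ (i,j) * (x i - \<mu> $ i) * (x j - \<mu> $ j))" for x
    using assms by (subst qform_sum[of _ n]) (auto intro!: sum.cong)
  then show ?thesis by simp
qed

text \<open>Positivity of the determinant comes out of the same induction, because
  \<open>det A = c * det B\<close> with a positive pivot \<open>c\<close>.\<close>

lemma nn_integral_gaussian: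
  assumes "A \<in> carrier_mat n n" "pos_def A" "\<mu> \<in> carrier_vec n"
  shows "0 < Determinant.det A"
    and "(\<integral>\<^sup>+x. ennreal (exp (- (1/2) * qform A (Matrix.vec n x - \<mu>))) \<partial>(\<Pi>\<^sub>M i\<in>{..<n}. lborel)) =
      ennreal (sqrt ((2 * pi) ^ n / Determinant.det A))"
proof -
  have "0 < Determinant.det A \<and>
    (\<integral>\<^sup>+x. ennreal (exp (- (1/2) * qform A (Matrix.vec n x - \<mu>))) \<partial>(\<Pi>\<^sub>M i\<in>{..<n}. lborel)) =
      ennreal (sqrt ((2 * pi) ^ n / Determinant.det A))"
    using assms
  proof (induction n arbitrary: A \<mu>)
    case 0
    then show ?case
      by (simp add: qform_sum[of _ 0] PiM_empty)
  next
    case (Suc n)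
    interpret product_sigma_finite "\<lambda>_. lborel :: real measure" ..
    define B where "B = schur_complement n A"
    define \<nu> where "\<nu> = Matrix.vec n (($) \<mu>)"
    define c where "c = A $$ (n,n)"
    \<comment> \<open>With the other coordinates fixed, the last one is Gaussian up to a factor,
      with mean \<open>m x\<close> and precision \<open>c\<close>.\<close>
    define m where "m x = \<mu> $ n - (\<Sum>i<n. A $$ (n,i) * (x i - \<mu> $ i)) / c" for x
    have c: "0 < c"
      using Suc.prems by (auto simp: c_def intro: pos_def_diag_pos)
    have sym: "transpose_mat A = A"
      using Suc.prems by (simp add: pos_def_iff)
    have B: "B \<in> carrier_mat n n" "pos_def B" and \<nu>: "\<nu> \<in> carrier_vec n"
      using Suc.prems by (auto simp: B_def \<nu>_def intro: pos_def_schur_complement)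
    note IH = Suc.IH[OF B \<nu>]
    have det: "Determinant.det A = c * Determinant.det B"
      using det_schur_complement[OF Suc.prems(1)] c by (simp add: B_def c_def)
    have split: "qform A (Matrix.vec (Suc n) (x(n := y)) - \<mu>) =
        qform B (Matrix.vec n x - \<nu>) + c * (y - m x)\<^sup>2" for x y
    proof -
      let ?u = "Matrix.vec (Suc n) (x(n := y)) - \<mu>"
      have u: "?u \<in> carrier_vec (Suc n)" and \<mu>: "dim_vec \<mu> = Suc n"
        using Suc.prems by auto
      have "Matrix.vec n (($) ?u) = Matrix.vec n x - \<nu>"
        using \<mu> by (auto simp: \<nu>_def)
      moreover have "?u $ n + (\<Sum>i<n. A $$ (n,i) * ?u $ i) / c = y - m x"
        using \<mu> by (simp add: m_def)
      ultimately show ?thesis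
        using qform_schur_complement[OF Suc.prems(1) sym _ u] c by (simp add: B_def c_def)
    qed
    let ?f = "\<lambda>x. ennreal (exp (- (1/2) * qform A (Matrix.vec (Suc n) x - \<mu>)))"
    have "(\<integral>\<^sup>+x. ?f x \<partial>(\<Pi>\<^sub>M i\<in>insert n {..<n}. lborel)) =
        (\<integral>\<^sup>+x. (\<integral>\<^sup>+y. ?f (x(n := y)) \<partial>lborel) \<partial>(\<Pi>\<^sub>M i\<in>{..<n}. lborel))"
      using qform_measurable[OF Suc.prems(1,3)]
      by (intro product_nn_integral_insert) (auto simp flip: lessThan_Suc)
    also have "\<dots> = (\<integral>\<^sup>+x. ennreal (exp (- (1/2) * qform B (Matrix.vec n x - \<nu>))) *
        ennreal (sqrt (2 * pi / c)) \<partial>(\<Pi>\<^sub>M i\<in>{..<n}. lborel))"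
    proof (intro nn_integral_cong)
      fix x :: "nat \<Rightarrow> real"
      have "?f (x(n := y)) = ennreal (exp (- (1/2) * qform B (Matrix.vec n x - \<nu>))) *
          ennreal (exp (- (1/2) * (c * (y - m x)\<^sup>2)))" for y
        by (simp only: split distrib_left exp_add ennreal_mult'[OF exp_ge_zero])
      moreover have "(\<lambda>y. ennreal (exp (- (1/2) * (c * (y - m x)\<^sup>2)))) \<in> borel_measurable lborel"
        by measurable
      ultimately show "(\<integral>\<^sup>+y. ?f (x(n := y)) \<partial>lborel) =
          ennreal (exp (- (1/2) * qform B (Matrix.vec n x - \<nu>))) * ennreal (sqrt (2 * pi / c))"
        by (simp only: nn_integral_cmult nn_integral_gaussian_real[OF c])
    qed
    also have "\<dots> = ennreal (sqrt ((2 * pi) ^ n / Determinant.det B)) * ennreal (sqrt (2 * pi / c))"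
      using IH qform_measurable[OF B(1) \<nu>] by (subst nn_integral_multc) auto
    also have "\<dots> = ennreal (sqrt ((2 * pi) ^ Suc n / Determinant.det A))"
    proof -
      have "sqrt ((2 * pi) ^ n / Determinant.det B) * sqrt (2 * pi / c) =
          sqrt ((2 * pi) ^ Suc n / Determinant.det A)"
        by (simp add: det mult_ac flip: real_sqrt_mult)
      then show ?thesis
        using c by (subst ennreal_mult''[symmetric]) simp_all
    qed
    finally show ?case
      using c IH det by (simp add: lessThan_Suc)
  qed
  then show "0 < Determinant.det A"
    and "(\<integral>\<^sup>+x. ennreal (exp (- (1/2) * qform A (Matrix.vec n x - \<mu>))) \<partial>(\<Pi>\<^sub>M i\<in>{..<n}. lborel)) =
      ennreal (sqrt ((2 * pi) ^ n / Determinant.det A))"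
    by auto
qed

section \<open>Determinants and inverses under the Loewner order\<close>

lemma det_mono_loewner:
  assumes A: "A \<in> carrier_mat n n" "pos_def A" and B: "B \<in> carrier_mat n n" "pos_def B"
    and le: "A \<preceq>\<^sub>L B"
  shows "Determinant.det A \<le> Determinant.det B"
proof -
  txt \<open>Compare the Gaussian integrals, which are decreasing in the precision matrix.\<close>
  have z: "(0\<^sub>v n :: real vec) \<in> carrier_vec n" by simp
  note gA = nn_integral_gaussian[OF A z] and gB = nn_integral_gaussian[OF B z]
  have "ennreal (sqrt ((2 * pi) ^ n / Determinant.det B)) \<le> ennreal (sqrt ((2 * pi) ^ n / Determinant.det A))"
    unfolding gA(2)[symmetric] gB(2)[symmetric]
    using loewner_le_qform[OF A(1) B(1) _ le] by (intro nn_integral_mono ennreal_leI) auto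
  then have "(2 * pi) ^ n / Determinant.det B \<le> (2 * pi) ^ n / Determinant.det A"
    using gA(1) by (simp add: ennreal_le_iff)
  then show ?thesis
    using gA(1) gB(1) by (simp add: field_simps)
qed

text \<open>The determinant is positive by the Gaussian integral, so \<open>mat_inverse\<close>
  returns a genuine inverse. Symmetry of \<open>J\<close> is uniqueness of inverses, and the form of
  \<open>J\<close> at \<open>v\<close> equals the form of \<open>S\<close> at \<open>J v\<close>,
  which is nonzero if \<open>v\<close> is.\<close>

lemma pos_def_inverse:
  assumes S: "S \<in> carrier_mat n n" "pos_def S"
  defines "J \<equiv> the (mat_inverse S)"
  shows "S * J = 1\<^sub>m n" "J * S = 1\<^sub>m n" "J \<in> carrier_mat n n" "pos_def J"
    and "Determinant.det J = 1 / Determinant.det S"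
proof -
  have det: "Determinant.det S > 0"
    using nn_integral_gaussian(1)[OF S zero_carrier_vec] .
  then have "mat_inverse S \<noteq> None"
    using mat_inverse(1)[OF S(1)] det_non_zero_imp_unit[OF S(1)] by fastforce
  then show J: "S * J = 1\<^sub>m n" "J * S = 1\<^sub>m n" "J \<in> carrier_mat n n"
    using mat_inverse(2)[OF S(1)] by (auto simp: J_def)
  have "Determinant.det S * Determinant.det J = 1"
    using det_mult[OF S(1) J(3)] J(1) by simp
  then show "Determinant.det J = 1 / Determinant.det S"
    using det by (simp add: field_simps)
  have sym: "transpose_mat S = S"
    using S by (simp add: pos_def_iff)
  have "transpose_mat J * S = 1\<^sub>m n"
    using transpose_mult[OF S(1) J(3)] J(1) sym by simp
  then have "transpose_mat J * (S * J) = J"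
    using assoc_mult_mat[of "transpose_mat J" n n S n J n] S(1) J(3) by simp
  then have "transpose_mat J = J"
    using J by simp
  moreover have "0 < qform J v" if v: "v \<in> carrier_vec n" "v \<noteq> 0\<^sub>v n" for v
  proof -
    let ?w = "J *\<^sub>v v"
    have w: "?w \<in> carrier_vec n" and Sw: "S *\<^sub>v ?w = v"
      using J S v by (auto simp flip: assoc_mult_mat_vec)
    have "S *\<^sub>v 0\<^sub>v n = 0\<^sub>v n"
      using S by (intro eq_vecI) auto
    then have "?w \<noteq> 0\<^sub>v n"
      using Sw v by metis
    then have "0 < qform S ?w"
      using S w by (simp add: pos_def_iff)
    then show ?thesis
      using w v Sw by (simp add: qform_def comm_scalar_prod[of _ n])
  qed
  ultimately show "pos_def J"
    using J(3) by (simp add: pos_def_iff)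
qed

lemma qform_inverse_antimono:
  assumes A: "A \<in> carrier_mat n n" "pos_def A" and B: "B \<in> carrier_mat n n" "pos_def B"
    and le: "c \<cdot>\<^sub>m A \<preceq>\<^sub>L B" and c: "0 < c" and u: "u \<in> carrier_vec n"
  shows "qform (the (mat_inverse B)) u \<le> qform (the (mat_inverse A)) u / c"
proof -
  let ?v = "the (mat_inverse A) *\<^sub>v u" and ?w = "the (mat_inverse B) *\<^sub>v u"
  note iA = pos_def_inverse[OF A] and iB = pos_def_inverse[OF B]
  have v: "?v \<in> carrier_vec n" and w: "?w \<in> carrier_vec n"
    using iA(3) iB(3) u by auto
  have Av: "A *\<^sub>v ?v = u" and Bw: "B *\<^sub>v ?w = u"
    using A B iA iB u by (auto simp flip: assoc_mult_mat_vec)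
  have sym: "transpose_mat A = A"
    using A by (simp add: pos_def_iff)
  have d: "?v - c \<cdot>\<^sub>v ?w \<in> carrier_vec n"
    using v w by auto
  txt \<open>Completing the square: expand \<open>\<langle>v - c w, A (v - c w)\<rangle> \<ge> 0\<close>, where \<open>A v = u = B w\<close>.\<close>
  have "0 \<le> qform A (?v - c \<cdot>\<^sub>v ?w)"
    using A d pos_def_iff[OF A(1)] by (cases "?v - c \<cdot>\<^sub>v ?w = 0\<^sub>v n")
      (auto simp: qform_def intro: less_imp_le)
  also have "qform A (?v - c \<cdot>\<^sub>v ?w) =
      scalar_prod ?v u - 2 * c * scalar_prod ?w u + c\<^sup>2 * qform A ?w"
  proof -
    have "scalar_prod ?v (A *\<^sub>v ?w) = scalar_prod ?w u"
      using transpose_vec_mult_scalar[OF A(1) w v] A v w u Av sym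
      by (metis comm_scalar_prod mult_mat_vec_carrier)
    then show ?thesis
      using A(1) v w u
      by (simp add: qform_def mult_minus_distrib_mat_vec[of _ n n] mult_mat_vec[of _ n n] Av
          minus_scalar_prod_distrib[of _ n] scalar_prod_minus_distrib[of _ n]
          power2_eq_square algebra_simps)
  qed
  \<comment> \<open>The Loewner bound enters here, tested at \<open>?w\<close>. The quadratic term
    then offsets at most half of the cross term \<open>2 * c * scalar_prod ?w u\<close>.\<close>
  also have "c\<^sup>2 * qform A ?w \<le> c * scalar_prod ?w u"
  proof -
    have "c * qform A ?w \<le> qform B ?w"
      using loewner_le_qform[OF _ B(1) w le] A w by (simp add: qform_smult)
    then show ?thesis
      using c by (simp add: qform_def Bw power2_eq_square mult.assoc mult_left_mono)
  qed
  finally have "c * scalar_prod ?w u \<le> scalar_prod ?v u"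
    by simp
  then show ?thesis
    using c v w u by (simp add: qform_def field_simps comm_scalar_prod[of u n])
qed

section \<open>The divergence bound in a fixed dimension\<close>

text \<open>The integrand is dominated pointwise by a function with known integral. The first
  summand of the bound pays for the difference of the quadratic forms, and 1/2 pays for the
  determinants. The parameter \<open>s\<close> stays free so that it can be tuned to
  \<open>n\<close> later.\<close>

lemma D_KL_mvn_le:
  assumes S0: "S0 \<in> carrier_mat n n" "pos_def S0" and S1: "S1 \<in> carrier_mat n n" "pos_def S1"
    and \<mu>: "\<mu> \<in> carrier_vec n" and n: "2 \<le> n"
    and le0: "(1 - 1 / real n) \<cdot>\<^sub>m S0 \<preceq>\<^sub>L S1" and le1: "S1 \<preceq>\<^sub>L (1 + 1 / real n) \<cdot>\<^sub>m S0"
    and s: "0 < s" "s < 1"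
  shows "D_KL (mvn n \<mu> S0) (mvn n \<mu> S1) \<le>
    1 / ((real n - 1) * s) * ((1 - s) powr (- real n / 2) - 1) + 1 / 2"
proof -
  let ?L = "\<Pi>\<^sub>M i\<in>{..<n}. lborel :: real measure"
  interpret product_sigma_finite "\<lambda>_. lborel :: real measure" ..
  interpret sigma_finite_measure ?L
    by (rule sigma_finite) simp
  define J0 where "J0 = the (mat_inverse S0)"
  define J1 where "J1 = the (mat_inverse S1)"
  note i0 = pos_def_inverse[OF S0, folded J0_def] and i1 = pos_def_inverse[OF S1, folded J1_def]
  define d0 where "d0 = Determinant.det S0"
  define d1 where "d1 = Determinant.det S1"
  have d: "0 < d0" "0 < d1"
    using nn_integral_gaussian(1) S0 S1 \<mu> by (auto simp: d0_def d1_def)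
  define Q0 where "Q0 x = qform J0 (Matrix.vec n x - \<mu>)" for x
  define Q1 where "Q1 x = qform J1 (Matrix.vec n x - \<mu>)" for x
  have [measurable]: "Q0 \<in> borel_measurable ?L" "Q1 \<in> borel_measurable ?L"
    using i0(3) i1(3) \<mu> by (auto simp: Q0_def[abs_def] Q1_def[abs_def] intro!: qform_measurable)
  define p where "p = mvn_density n \<mu> S0"
  define q where "q = mvn_density n \<mu> S1"
  define Z0 where "Z0 = sqrt ((2 * pi) ^ n * d0)"
  define Z1 where "Z1 = sqrt ((2 * pi) ^ n * d1)"
  have Z: "0 < Z0" "0 < Z1"
    using d by (auto simp: Z0_def Z1_def)
  have p: "p x = exp (- (1/2) * Q0 x) / Z0" and q: "q x = exp (- (1/2) * Q1 x) / Z1" for x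
    by (simp_all add: p_def q_def mvn_density_def Q0_def Q1_def qform_def J0_def J1_def Z0_def Z1_def
        d0_def d1_def)
  have [measurable]: "p \<in> borel_measurable ?L" "q \<in> borel_measurable ?L"
    by (simp_all add: p[abs_def] q[abs_def])
  have pos: "0 < p x" "0 < q x" for x
    using Z by (auto simp: p q)
  \<comment> \<open>Since \<open>q\<close> never vanishes, absolute continuity is immediate; the
    logarithm to base \<open>exp 1\<close> is \<open>ln\<close>.\<close>
  have KL: "D_KL (mvn n \<mu> S0) (mvn n \<mu> S1) = (\<integral>x. p x * ln (p x / q x) \<partial>?L)"
    unfolding D_KL_def mvn_def p_def[symmetric] q_def[symmetric]
    by (subst KL_density_density) (auto simp: log_def less_imp_le[OF pos(1)] less_imp_le[OF pos(2)]
        less_imp_neq[OF pos(2), symmetric])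

  \<comment> \<open>The exponential weight changes the precision matrix from \<open>J0\<close> to
    \<open>(1 - t) J0\<close>, which is still positive definite for \<open>t < 1\<close>. Its
    determinant gains the factor \<open>(1 - t) ^ n\<close>, and everything else cancels against
    \<open>Z0\<close>. The case \<open>t = 0\<close> says that \<open>p\<close> has total mass
    1.\<close>
  have tilt: "has_bochner_integral ?L (\<lambda>x. p x * exp (t / 2 * Q0 x)) ((1 - t) powr (- real n / 2))"
    if t: "t < 1" for t
  proof (rule has_bochner_integral_nn_integral)
    have "(\<integral>\<^sup>+x. ennreal (p x * exp (t / 2 * Q0 x)) \<partial>?L) =
        (\<integral>\<^sup>+x. ennreal (1 / Z0) *
          ennreal (exp (- (1/2) * qform ((1 - t) \<cdot>\<^sub>m J0) (Matrix.vec n x - \<mu>))) \<partial>?L)"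
    proof (intro nn_integral_cong)
      fix x
      have "qform ((1 - t) \<cdot>\<^sub>m J0) (Matrix.vec n x - \<mu>) = (1 - t) * Q0 x"
        using i0(3) \<mu> by (simp add: Q0_def qform_smult[of _ n])
      then show "ennreal (p x * exp (t / 2 * Q0 x)) = ennreal (1 / Z0) *
          ennreal (exp (- (1/2) * qform ((1 - t) \<cdot>\<^sub>m J0) (Matrix.vec n x - \<mu>)))"
        using Z by (simp add: p algebra_simps diff_divide_distrib flip: ennreal_mult' exp_add)
    qed
    also have "\<dots> = ennreal (1 / Z0) * ennreal (sqrt ((2 * pi) ^ n / ((1 - t) ^ n * (1 / d0))))"
    proof -
      have J: "(1 - t) \<cdot>\<^sub>m J0 \<in> carrier_mat n n" "pos_def ((1 - t) \<cdot>\<^sub>m J0)"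
        and det: "Determinant.det ((1 - t) \<cdot>\<^sub>m J0) = (1 - t) ^ n * (1 / d0)"
        using i0 t by (auto simp: d0_def intro: pos_def_smult)
      note [measurable] = qform_measurable[OF J(1) \<mu>]
      have "(\<lambda>x. ennreal (exp (- (1/2) * qform ((1 - t) \<cdot>\<^sub>m J0) (Matrix.vec n x - \<mu>))))
          \<in> borel_measurable ?L"
        by measurable
      then show ?thesis
        by (simp only: nn_integral_cmult nn_integral_gaussian(2)[OF J \<mu>] det)
    qed
    also have "\<dots> = ennreal (1 / Z0 * sqrt ((2 * pi) ^ n / ((1 - t) ^ n * (1 / d0))))"
      using Z by (intro ennreal_mult'[symmetric]) simp
    also have "1 / Z0 * sqrt ((2 * pi) ^ n / ((1 - t) ^ n * (1 / d0))) = 1 / sqrt ((1 - t) ^ n)"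
      using d t by (simp add: Z0_def real_sqrt_mult real_sqrt_divide)
    also have "\<dots> = (1 - t) powr (- real n / 2)"
      using t by (simp add: powr_minus_divide powr_half_sqrt[symmetric] powr_powr flip: powr_realpow)
    finally show "(\<integral>\<^sup>+x. ennreal (p x * exp (t / 2 * Q0 x)) \<partial>?L) =
        ennreal ((1 - t) powr (- real n / 2))" .
  qed (use pos in \<open>auto simp: less_imp_le\<close>)

  have int1: "has_bochner_integral ?L p 1"
    using tilt[of 0] by simp
  \<comment> \<open>Chosen so that \<open>k * (s / 2 * Q0 x)\<close> is
    \<open>Q0 x / (2 * (n - 1))\<close>, the bound on half the difference of the quadratic forms.
    The majorant \<open>?h\<close> below is
    \<open>p x * (k * (exp (s / 2 * Q0 x) - 1) + 1 / 2)\<close> multiplied out.\<close>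
  define k where "k = 1 / ((real n - 1) * s)"
  have k: "0 < k"
    using n s by (simp add: k_def)
  let ?h = "\<lambda>x. k * (p x * exp (s / 2 * Q0 x)) + (1 / 2 - k) * p x"
  have int_h: "has_bochner_integral ?L ?h (k * (1 - s) powr (- real n / 2) + (1 / 2 - k) * 1)"
    by (intro has_bochner_integral_add has_bochner_integral_mult_right tilt int1 s)

  \<comment> \<open>The square roots in the normalising constants halve \<open>ln (d1 / d0)\<close>,
    which is at most 1.\<close>
  have logdet: "ln (Z1 / Z0) \<le> 1 / 2"
  proof -
    have "d1 \<le> Determinant.det ((1 + 1 / real n) \<cdot>\<^sub>m S0)"
      unfolding d1_def using S0 S1 le1
      by (intro det_mono_loewner[of _ n] pos_def_smult[of _ n]) (auto intro: add_pos_nonneg)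
    also have "\<dots> = (1 + 1 / real n) ^ n * d0"
      using S0 by (simp add: d0_def)
    also have "\<dots> \<le> exp (1 / real n) ^ n * d0"
      using d by (intro mult_right_mono power_mono) auto
    also have "exp (1 / real n) ^ n = exp 1"
      using n by (simp flip: exp_of_nat_mult)
    finally have "d1 / d0 \<le> exp 1"
      using d by (simp add: field_simps)
    then have "ln (d1 / d0) \<le> 1"
      using d ln_le_cancel_iff[of "d1 / d0" "exp 1"] by simp
    moreover have "Z1 / Z0 = sqrt (d1 / d0)"
      using d by (simp add: Z0_def Z1_def real_sqrt_mult real_sqrt_divide)
    ultimately show ?thesis
      using d by (simp add: ln_sqrt)
  qed

  have bound: "p x * ln (p x / q x) \<le> ?h x" for x
  proof -
    have "Q1 x \<le> Q0 x / (1 - 1 / real n)"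
      unfolding Q0_def Q1_def J0_def J1_def using n \<mu> S0 S1 le0
      by (intro qform_inverse_antimono) auto
    \<comment> \<open>This is 1 / (1 - 1/n) = 1 + 1/(n - 1).\<close>
    also have "\<dots> = Q0 x + Q0 x / (real n - 1)"
      using n by (simp add: field_simps)
    finally have "Q1 x - Q0 x \<le> Q0 x / (real n - 1)"
      by simp
    then have "(Q1 x - Q0 x) / 2 \<le> Q0 x / (real n - 1) / 2"
      by (rule divide_right_mono) simp
    also have "\<dots> = k * (s / 2 * Q0 x)"
      using n s by (simp add: k_def)
    also have "\<dots> \<le> k * (exp (s / 2 * Q0 x) - 1)"
      using k exp_ge_add_one_self[of "s / 2 * Q0 x"]
      by (intro mult_left_mono) (linarith | simp)+
    finally have "(Q1 x - Q0 x) / 2 + ln (Z1 / Z0) \<le> k * (exp (s / 2 * Q0 x) - 1) + 1 / 2"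
      using logdet by (rule add_mono)
    moreover have "- (1/2) * Q0 x = (Q1 x - Q0 x) / 2 + - (1/2) * Q1 x"
      by (simp add: field_simps)
    then have "exp (- (1/2) * Q0 x) = exp ((Q1 x - Q0 x) / 2) * exp (- (1/2) * Q1 x)"
      by (simp only: exp_add)
    then have "p x / q x = exp ((Q1 x - Q0 x) / 2) * (Z1 / Z0)"
      by (simp add: p q)
    then have "ln (p x / q x) = (Q1 x - Q0 x) / 2 + ln (Z1 / Z0)"
      using Z by (simp add: ln_mult ln_div)
    ultimately have "ln (p x / q x) \<le> k * (exp (s / 2 * Q0 x) - 1) + 1 / 2"
      by simp
    then have "p x * ln (p x / q x) \<le> p x * (k * (exp (s / 2 * Q0 x) - 1) + 1 / 2)"
      using pos[of x] by (intro mult_left_mono) auto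
    then show ?thesis by (simp add: algebra_simps)
  qed
  let ?b = "k * ((1 - s) powr (- real n / 2) - 1) + 1 / 2"
  have int_h': "integrable ?L ?h" "integral\<^sup>L ?L ?h = ?b"
    using int_h by (auto simp: has_bochner_integral_iff algebra_simps)
  have "(\<integral>x. p x * ln (p x / q x) \<partial>?L) \<le> ?b"
  proof (cases "integrable ?L (\<lambda>x. p x * ln (p x / q x))")
    case True
    then show ?thesis
      using integral_mono[OF True int_h'(1) bound] int_h'(2) by simp
  next
    case False
    \<comment> \<open>Without integrability the Bochner integral has the default value 0, so it
      suffices that the bound is nonnegative.\<close>
    have "1 \<le> (1 - s) powr (- real n / 2)"
      using s by (simp add: powr_minus_divide powr_le_one_le powr_le1)
    then have "0 \<le> ?b"
      using k by simp
    then show ?thesis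
      using False by (simp add: not_integrable_integral_eq)
  qed
  then show ?thesis
    by (simp add: KL k_def)
qed

section \<open>Asymptotics in the dimension\<close>

theorem lemma1:
  shows "\<exists>\<epsilon> \<in> O(\<lambda>n::nat. 1 / real n). \<forall>\<^sub>F n in sequentially.
    \<forall>(\<mu> :: real vec) (\<Sigma>\<^sub>0 :: real mat) (\<Sigma>\<^sub>1 :: real mat).
      \<mu> \<in> carrier_vec n \<longrightarrow>
      \<Sigma>\<^sub>0 \<in> carrier_mat n n \<longrightarrow> \<Sigma>\<^sub>1 \<in> carrier_mat n n \<longrightarrow>
      pos_def \<Sigma>\<^sub>0 \<longrightarrow> pos_def \<Sigma>\<^sub>1 \<longrightarrow>
      (1 - 1 / real n) \<cdot>\<^sub>m \<Sigma>\<^sub>0 \<preceq>\<^sub>L \<Sigma>\<^sub>1 \<longrightarrow>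
      \<Sigma>\<^sub>1 \<preceq>\<^sub>L (1 + 1 / real n) \<cdot>\<^sub>m \<Sigma>\<^sub>0 \<longrightarrow>
      D_KL (mvn n \<mu> \<Sigma>\<^sub>0) (mvn n \<mu> \<Sigma>\<^sub>1) \<le> 1 + (\<epsilon> n :: real)"
proof (intro bexI)
  \<comment> \<open>The bound of \<open>D_KL_mvn_le\<close> at \<open>s = 1 / n^2\<close>, minus 1.
    For small \<open>n * s\<close> the first summand of that bound is 1/2 up to errors of order
    \<open>1 / n\<close> and \<open>n * s\<close>, so \<open>s\<close> of order
    \<open>1 / n^2\<close> gives the required rate. Here the second factor is 1/(2n) + O(1/n^2) and
    the first is n + O(1), so their product is 1/2 + O(1/n).\<close>
  let ?\<epsilon> = "\<lambda>n::nat. 1 / ((real n - 1) * (1 / real n ^ 2)) *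
    ((1 - 1 / real n ^ 2) powr (- real n / 2) - 1) - 1 / 2"
  show "?\<epsilon> \<in> O(\<lambda>n. 1 / real n)"
    by real_asymp
  show "\<forall>\<^sub>F n in sequentially.
    \<forall>(\<mu> :: real vec) (\<Sigma>\<^sub>0 :: real mat) (\<Sigma>\<^sub>1 :: real mat).
      \<mu> \<in> carrier_vec n \<longrightarrow>
      \<Sigma>\<^sub>0 \<in> carrier_mat n n \<longrightarrow> \<Sigma>\<^sub>1 \<in> carrier_mat n n \<longrightarrow>
      pos_def \<Sigma>\<^sub>0 \<longrightarrow> pos_def \<Sigma>\<^sub>1 \<longrightarrow>
      (1 - 1 / real n) \<cdot>\<^sub>m \<Sigma>\<^sub>0 \<preceq>\<^sub>L \<Sigma>\<^sub>1 \<longrightarrow>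
      \<Sigma>\<^sub>1 \<preceq>\<^sub>L (1 + 1 / real n) \<cdot>\<^sub>m \<Sigma>\<^sub>0 \<longrightarrow>
      D_KL (mvn n \<mu> \<Sigma>\<^sub>0) (mvn n \<mu> \<Sigma>\<^sub>1) \<le> 1 + ?\<epsilon> n"
    \<comment> \<open>From dimension 2 on, \<open>s = 1 / n^2\<close> lies strictly below 1 and
      \<open>1 - 1 / n\<close> is positive.\<close>
    using eventually_ge_at_top[of "2::nat"]
  proof eventually_elim
    case (elim n)
    have "0 < 1 / real n ^ 2" "1 / real n ^ 2 < 1"
      using elim by (auto simp: power2_eq_square field_simps intro: le_less_trans[of _ "real n"])
    from D_KL_mvn_le[OF _ _ _ _ _ elim _ _ this] show ?case
      by (auto simp: algebra_simps)
  qed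
qed

end
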